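(* Let $n\ge 0$ and let $S^n=\{x\in\mathbb R^{n+1}:\|x\|=1\}$ be the unit sphere of the Euclidean space $\mathbb R^{n+1}$, with the natural action of the group $\mathsf{SO}(n+1)$ of orientation-preserving linear isometries of $\mathbb R^{n+1}$. Then $S^n$ admits an $\mathsf{SO}(n+1)$-invariant binary closed $k$-network (i.e. $S^n$ is $\mathsf{SO}(n+1)$-supercompact) if and only if $n\le 1$.
   Context: A family $\mathcal A$ of sets is linked if $A\cap B\neq\emptyset$ for all $A,B\in\mathcal A$; centered if every finite subfamily has nonempty intersection; binary if every linked subfamily of $\mathcal A$ is centered. A family $\mathcal N$ of closed subsets of a topological space $X$ is a closed $k$-network if for every open $U\subset X$ and every compact $K\subset U$ there is a finite $\mathcal F\subset\mathcal N$ with $K\subset\bigcup\mathcal F\subset U$. If a group $G$ acts on $X$, a family $\mathcal F$ of subsets of $X$ is $G$-invariant if $gF\in\mathcal F$ for all $F\in\mathcal F$, $g\in G$. A compact $G$-space is $G$-supercompact if it admits a $G$-invariant binary closed $k$-network. *)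

theory Defs
  imports "HOL-Analysis.Analysis"
begin

definition linked_family :: "'a set set \<Rightarrow> bool" where
  "linked_family \<A> \<longleftrightarrow> (\<forall>A\<in>\<A>. \<forall>B\<in>\<A>. A \<inter> B \<noteq> {})"

definition centered_family :: "'a set set \<Rightarrow> bool" where
  "centered_family \<A> \<longleftrightarrow> (\<forall>\<F>. \<F> \<subseteq> \<A> \<and> finite \<F> \<longrightarrow> \<Inter>\<F> \<noteq> {})"

definition binary_family :: "'a set set \<Rightarrow> bool" where
  "binary_family \<A> \<longleftrightarrow> (\<forall>\<B>. \<B> \<subseteq> \<A> \<and> linked_family \<B> \<longrightarrow> centered_family \<B>)"

definition closed_k_network :: "'a topology \<Rightarrow> 'a set set \<Rightarrow> bool" where
  "closed_k_network X \<N> \<longleftrightarrow>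
     (\<forall>N\<in>\<N>. closedin X N) \<and>
     (\<forall>U K. openin X U \<and> compactin X K \<and> K \<subseteq> U \<longrightarrow>
        (\<exists>\<F>. finite \<F> \<and> \<F> \<subseteq> \<N> \<and> K \<subseteq> \<Union>\<F> \<and> \<Union>\<F> \<subseteq> U))"

definition G_invariant :: "('a \<Rightarrow> 'a) set \<Rightarrow> 'a set set \<Rightarrow> bool" where
  "G_invariant G \<F> \<longleftrightarrow> (\<forall>g\<in>G. \<forall>F\<in>\<F>. g ` F \<in> \<F>)"

definition G_supercompact :: "'a topology \<Rightarrow> ('a \<Rightarrow> 'a) set \<Rightarrow> bool" where
  "G_supercompact X G \<longleftrightarrow> compact_space X \<and>
     (\<exists>\<N>. G_invariant G \<N> \<and> binary_family \<N> \<and> closed_k_network X \<N>)"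

definition SO_group :: "((real^'n) \<Rightarrow> (real^'n)) set" where
  "SO_group = {f. orthogonal_transformation f \<and> det (matrix f) = 1}"

end

theory Submission
  imports Defs
begin

text \<open>
  For \<open>n \<le> 1\<close> the caps of chordal radius at most \<open>1/2\<close> work: a linked family of them avoids the point
  antipodal to the centre of any member, so it lives in a space embedded in the line, where
  pairwise intersecting intervals have a common point.

  For \<open>n \<ge> 2\<close>, an invariant binary closed \<open>k\<close>-network has a small member \<open>N\<close> containing a cap, and this
  cap can be enlarged until there are points \<open>b \<notin> N\<close> arbitrarily close to it. Let \<open>F\<close> be a much smaller
  member, of diameter attained at \<open>p, q \<in> F\<close>. One finds two rotated copies of \<open>F\<close>, both with \<open>q\<close> placed at
  \<open>b\<close>, that meet each other only in \<open>b\<close> and both meet \<open>N\<close>; with \<open>N\<close> they form a linked family without a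
  common point. If \<open>F\<close> lies in the cone of half-angle 45 degrees about the direction from \<open>q\<close> to \<open>p\<close>, then
  the two copies of \<open>p\<close> can be bent towards \<open>N\<close>. Otherwise the copies of \<open>p\<close> are placed exactly opposite
  to each other across \<open>b\<close>, which makes the copies tangent by maximality of the diameter; their common axis
  is tilted so that one copy of \<open>p\<close> enters \<open>N\<close>, and a point of \<open>F\<close> outside the cone makes the other copy
  reach \<open>N\<close>.
\<close>

section \<open>Reflections and rotations\<close>

text \<open>The normal \<open>u\<close> need not be a unit vector, and for \<open>u = 0\<close>
  division by zero yields the identity. The extension of isometries below can therefore use a
  difference of two points as normal even when the points coincide.\<close>

definition reflection_along :: "'a::euclidean_space \<Rightarrow> 'a \<Rightarrow> 'a" where
  "reflection_along u x = x - (2 * (x \<bullet> u) / (u \<bullet> u)) *\<^sub>R u"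

lemma orthogonal_transformation_reflection_along:
  "orthogonal_transformation (reflection_along u)"
proof -
  have "linear (reflection_along u)"
    by (rule linearI)
       (simp_all add: reflection_along_def algebra_simps inner_left_distrib add_divide_distrib)
  moreover have "reflection_along u v \<bullet> reflection_along u w = v \<bullet> w" for v w
  proof (cases "u = 0")
    case False
    then have "u \<bullet> u \<noteq> 0" by simp
    then show ?thesis
      by (simp add: reflection_along_def inner_diff_left inner_diff_right inner_commute field_simps)
  qed (simp add: reflection_along_def)
  ultimately show ?thesis
    by (simp add: orthogonal_transformation_def)
qed

lemma reflection_along_orthogonal: "x \<bullet> u = 0 \<Longrightarrow> reflection_along u x = x"
  by (simp add: reflection_along_def)

lemma reflection_along_diff:
  assumes "norm x = norm y"
  shows "reflection_along (x - y) x = y"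
proof (cases "x = y")
  case False
  have eq: "x \<bullet> x = y \<bullet> y"
    using assms by (simp add: norm_eq)
  have "(x - y) \<bullet> (x - y) = 2 * (x \<bullet> (x - y))"
    by (simp add: inner_diff_left inner_diff_right inner_commute eq)
  moreover have "(x - y) \<bullet> (x - y) \<noteq> 0"
    using False unfolding inner_eq_zero_iff by simp
  ultimately have "2 * (x \<bullet> (x - y)) / ((x - y) \<bullet> (x - y)) = 1"
    by (metis divide_self)
  then show ?thesis
    unfolding reflection_along_def by (simp only: scaleR_one) simp
qed (simp add: reflection_along_def)

text \<open>Conjugating by an orthogonal map that carries a multiple of a basis vector to
  \<open>u\<close> keeps the determinant and leaves a diagonal matrix with a single entry
  -1.\<close>

lemma det_reflection_along:
  fixes u :: "real^'n"
  assumes "u \<noteq> 0"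
  shows "det (matrix (reflection_along u)) = -1"
proof -
  fix k :: 'n
  define a :: "real^'n" where "a = norm u *\<^sub>R axis k 1"
  obtain f where f: "orthogonal_transformation f" "f a = u"
    by (rule orthogonal_transformation_exists [of a u]) (simp_all add: a_def)
  have lin: "linear f" "\<And>v w. f v \<bullet> f w = v \<bullet> w"
    using f by (simp_all add: orthogonal_transformation_def)
  have comm: "reflection_along u \<circ> f = f \<circ> reflection_along a"
    using lin f(2) [symmetric]
    by (auto simp: reflection_along_def linear_diff linear_scale fun_eq_iff)
  have linr: "linear (reflection_along v)" for v :: "real^'n"
    using orthogonal_transformation_reflection_along orthogonal_transformation_linear by blast
  have "det (matrix (reflection_along u)) * det (matrix f)
      = det (matrix f) * det (matrix (reflection_along a))"
    using arg_cong [OF comm, of "\<lambda>h. det (matrix h)"]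
    by (simp add: matrix_compose lin linr det_mul)
  moreover have "det (matrix f) \<noteq> 0"
    using orthogonal_transformation_det [OF f(1)] by auto
  moreover have "det (matrix (reflection_along a)) = -1"
  proof -
    let ?D = "matrix (reflection_along a)"
    have entry: "?D $ i $ j = (if i = j then if i = k then -1 else 1 else 0)" for i j
    proof -
      have "reflection_along a (axis j 1)
          = axis j 1 - (2 * (axis j 1 \<bullet> (axis k 1 :: real^'n))) *\<^sub>R axis k 1"
        using assms by (simp add: reflection_along_def a_def inner_axis_axis)
      then show ?thesis
        by (simp add: matrix_def inner_axis_axis) (simp add: axis_def)
    qed
    have "det ?D = (\<Prod>i\<in>UNIV. ?D $ i $ i)"
      by (rule det_diagonal) (simp add: entry)
    also have "\<dots> = -1"
      by (simp add: entry)
    finally show ?thesis .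
  qed
  ultimately show ?thesis
    by (metis mult.commute mult_cancel_left)
qed

section \<open>Rotations with prescribed values\<close>

text \<open>Three reflections suffice. Each moves the next point to its target; its normal is
  orthogonal to the targets already reached, because the inner products agree, so those stay
  fixed.\<close>

lemma orthogonal_transformation_extending_isometry:
  fixes x y z x' y' z' :: "'a::euclidean_space"
  assumes "norm x = norm x'" "norm y = norm y'" "norm z = norm z'"
    and "x \<bullet> y = x' \<bullet> y'" "x \<bullet> z = x' \<bullet> z'" "y \<bullet> z = y' \<bullet> z'"
  obtains f where "orthogonal_transformation f" "f x = x'" "f y = y'" "f z = z'"
proof -
  note [simp] = orthogonal_transformation_reflection_along
  define f where "f = reflection_along (x - x')"
  have f: "orthogonal_transformation f" "f x = x'"
    using assms by (simp_all add: f_def reflection_along_diff)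
  have fi: "f v \<bullet> f w = v \<bullet> w" "norm (f v) = norm v" for v w
    using f(1) by (simp_all add: orthogonal_transformation_def orthogonal_transformation_norm)
  define g where "g = reflection_along (f y - y') \<circ> f"
  have "x' \<bullet> (f y - y') = 0"
    using fi(1) [of x y] f(2) assms by (simp add: inner_diff_right)
  then have g: "orthogonal_transformation g" "g x = x'" "g y = y'"
    using assms f
    by (simp_all add: g_def orthogonal_transformation_compose reflection_along_orthogonal
        reflection_along_diff fi)
  have gi: "g v \<bullet> g w = v \<bullet> w" "norm (g v) = norm v" for v w
    using g(1) by (simp_all add: orthogonal_transformation_def orthogonal_transformation_norm)
  define h where "h = reflection_along (g z - z') \<circ> g"
  have "x' \<bullet> (g z - z') = 0" "y' \<bullet> (g z - z') = 0"
    using gi(1) [of x z] gi(1) [of y z] g assms by (simp_all add: inner_diff_right)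
  then have "orthogonal_transformation h" "h x = x'" "h y = y'" "h z = z'"
    using assms g
    by (simp_all add: h_def orthogonal_transformation_compose reflection_along_orthogonal
        reflection_along_diff gi)
  then show thesis
    by (rule that)
qed

lemma SO_or_reflected_SO:
  fixes f :: "real^'n \<Rightarrow> real^'n"
  assumes f: "orthogonal_transformation f" and "u \<noteq> 0"
  shows "f \<in> SO_group \<or> reflection_along u \<circ> f \<in> SO_group"
proof -
  have "det (matrix (reflection_along u \<circ> f)) = - det (matrix f)"
    using assms orthogonal_transformation_reflection_along [of u]
    by (simp add: matrix_compose orthogonal_transformation_linear det_mul det_reflection_along)
  moreover have "\<bar>det (matrix f)\<bar> = 1"
    using f by simp
  moreover have "orthogonal_transformation (reflection_along u \<circ> f)"
    using f by (simp add: orthogonal_transformation_compose orthogonal_transformation_reflection_along)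
  ultimately show ?thesis
    using f unfolding SO_group_def mem_Collect_eq by linarith
qed

lemma SO_inner: "g \<in> SO_group \<Longrightarrow> g x \<bullet> g y = x \<bullet> y"
  by (simp add: SO_group_def orthogonal_transformation_def)

lemma unit_orthogonal_to_two:
  fixes a b :: "'a::euclidean_space"
  assumes "3 \<le> DIM('a)"
  obtains u where "norm u = 1" "u \<bullet> a = 0" "u \<bullet> b = 0"
proof -
  have "dim {a, b} \<le> card {a, b}"
    by (rule dim_le_card') simp
  also have "\<dots> < DIM('a)"
    using assms card_insert_le_m1 [of 2 "{b}" a] by simp
  finally obtain x where x: "x \<noteq> 0" "\<And>y. y \<in> span {a, b} \<Longrightarrow> orthogonal x y"
    by (rule orthogonal_to_subspace_exists) blast
  have "x \<bullet> a = 0" "x \<bullet> b = 0"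
    using x(2) by (simp_all add: orthogonal_def span_base)
  then show thesis
    using x(1) that [of "x /\<^sub>R norm x"] by simp
qed

text \<open>Dimension at least three leaves a direction orthogonal to both targets; a reflection
  along it repairs a determinant of -1 without moving them.\<close>

lemma SO_two_point_transitive:
  fixes p q a b :: "real^'n"
  assumes "3 \<le> CARD('n)" "norm p = norm a" "norm q = norm b" "p \<bullet> q = a \<bullet> b"
  obtains g where "g \<in> SO_group" "g p = a" "g q = b"
proof -
  obtain f where f: "orthogonal_transformation f" "f p = a" "f q = b"
    using orthogonal_transformation_extending_isometry [of p a q b 0 0] assms by auto
  obtain u where u: "norm u = 1" "u \<bullet> a = 0" "u \<bullet> b = 0"
    using unit_orthogonal_to_two [of a b] assms(1) by auto
  then have "u \<noteq> 0" by auto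
  have "a \<bullet> u = 0" "b \<bullet> u = 0"
    using u by (simp_all add: inner_commute)
  then have "(reflection_along u \<circ> f) p = a" "(reflection_along u \<circ> f) q = b"
    by (simp_all add: f reflection_along_orthogonal)
  with f that SO_or_reflected_SO [OF f(1) \<open>u \<noteq> 0\<close>] show thesis
    by blast
qed

section \<open>Spheres of dimension at least two\<close>

lemma binary_family_three:
  assumes "binary_family \<N>" "A \<in> \<N>" "B \<in> \<N>" "C \<in> \<N>"
    and "A \<inter> B \<noteq> {}" "A \<inter> C \<noteq> {}" "B \<inter> C \<noteq> {}"
  shows "A \<inter> B \<inter> C \<noteq> {}"
proof -
  have "linked_family {A, B, C}"
    using assms unfolding linked_family_def by (auto simp: Int_commute)
  then have "centered_family {A, B, C}"
    using assms unfolding binary_family_def by simp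
  then have "\<Inter>{A, B, C} \<noteq> {}"
    unfolding centered_family_def by (metis finite.emptyI finite.insertI subset_refl)
  then show ?thesis
    by (simp add: Int_assoc)
qed

text \<open>A finite form of Baire's argument: if \<open>F\<close> does not contain
  \<open>V\<close>, then \<open>V - F\<close> is again open and nonempty, and the remaining sets
  cover it.\<close>

lemma finite_closed_cover_member_with_interior:
  assumes "finite \<F>" "\<And>F. F \<in> \<F> \<Longrightarrow> closedin X F" "openin X V" "V \<noteq> {}" "V \<subseteq> \<Union>\<F>"
  shows "\<exists>F\<in>\<F>. \<exists>W. openin X W \<and> W \<noteq> {} \<and> W \<subseteq> F"
  using assms
proof (induction \<F> arbitrary: V)
  case empty
  then show ?case by simp
next
  case (insert F \<F>)
  show ?case
  proof (cases "V \<subseteq> F")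
    case False
    have "openin X (V - F)"
      using insert.prems by (simp add: openin_diff)
    moreover have "V - F \<noteq> {}" "V - F \<subseteq> \<Union>\<F>"
      using False insert.prems by auto
    ultimately show ?thesis
      using insert.IH [of "V - F"] insert.prems(1) by blast
  qed (use insert.prems in blast)
qed

lemma small_network_member:
  fixes c :: "'a::euclidean_space"
  assumes net: "closed_k_network (top_of_set S) \<N>" and "c \<in> S" "0 < \<rho>" "compact S"
  obtains F c' r where "F \<in> \<N>" "compact F" "F \<subseteq> S" "F \<subseteq> ball c \<rho>"
    "c' \<in> S" "0 < r" "S \<inter> ball c' r \<subseteq> F"
proof -
  let ?K = "S \<inter> cball c (\<rho>/2)" and ?U = "S \<inter> ball c \<rho>"
  have "openin (top_of_set S) ?U" "compactin (top_of_set S) ?K" "?K \<subseteq> ?U"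
    using assms by (auto simp: compactin_subtopology compact_Int_closed)
  then obtain \<F> where \<F>: "finite \<F>" "\<F> \<subseteq> \<N>" "?K \<subseteq> \<Union>\<F>" "\<Union>\<F> \<subseteq> ?U"
    using net unfolding closed_k_network_def by metis
  have cl: "closedin (top_of_set S) F" if "F \<in> \<N>" for F
    using net that unfolding closed_k_network_def by blast
  have "\<exists>F\<in>\<F>. \<exists>W. openin (top_of_set S) W \<and> W \<noteq> {} \<and> W \<subseteq> F"
  proof (rule finite_closed_cover_member_with_interior [where V = "S \<inter> ball c (\<rho>/2)"])
    show "openin (top_of_set S) (S \<inter> ball c (\<rho>/2))"
      by (simp add: openin_open_Int)
    show "S \<inter> ball c (\<rho>/2) \<noteq> {}"
      using assms by auto
    show "S \<inter> ball c (\<rho>/2) \<subseteq> \<Union>\<F>"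
      using \<F>(3) ball_subset_cball [of c "\<rho>/2"] by blast
  qed (use \<F> cl in auto)
  then obtain F W c' where FW: "F \<in> \<F>" "openin (top_of_set S) W" "c' \<in> W" "W \<subseteq> F"
    by auto
  then obtain r where "r > 0" "ball c' r \<inter> S \<subseteq> W" "c' \<in> S"
    by (metis openin_contains_ball subsetD)
  moreover have "compact F" "F \<subseteq> S"
    using cl FW(1) \<F>(2) \<open>compact S\<close> closedin_compact closedin_imp_subset by (metis subsetD)+
  moreover have "F \<subseteq> ball c \<rho>"
    using \<F>(4) FW(1) by auto
  moreover have "F \<in> \<N>"
    using \<F>(2) FW(1) by auto
  moreover have "S \<inter> ball c' r \<subseteq> F"
    using FW(4) \<open>ball c' r \<inter> S \<subseteq> W\<close> by (simp add: Int_commute order_trans)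
  ultimately show thesis
    using that by blast
qed

section \<open>Inner products as distances, and the largest cap inside a member\<close>

lemma dist_unit_inner:
  fixes x y :: "'a::real_inner"
  assumes "norm x = 1" "norm y = 1"
  shows "(dist x y)\<^sup>2 = 2 - 2 * (x \<bullet> y)"
  using assms by (simp add: dist_norm power2_norm_eq_inner norm_eq_1 inner_diff_left inner_diff_right inner_commute)

lemma inner_unit_le_one:
  fixes x y :: "'a::real_inner"
  assumes "norm x = 1" "norm y = 1"
  shows "x \<bullet> y \<le> 1"
  using norm_cauchy_schwarz [of x y] assms by simp

text \<open>Enlarge the cap about \<open>c\<close> until its height bound is \<open>l\<close>, the
  supremum of the heights \<open>x \<bullet> c\<close> of points outside \<open>N\<close>;
  \<open>b\<close> is an outside point of height almost \<open>l\<close>, and \<open>v\<close> is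
  the tangent direction at \<open>b\<close> towards \<open>c\<close>. A point close to
  \<open>b\<close> whose \<open>v\<close>-component dominates the errors is then higher than
  \<open>l\<close>. Since \<omega> does not depend on \<epsilon>, the second member can be chosen
  small relative to \<omega>, and \<epsilon> afterwards relative to that member.\<close>

lemma flat_boundary_point:
  fixes N :: "'a::euclidean_space set"
  assumes dim: "3 \<le> DIM('a)" and c: "norm c = 1" and "0 < r"
    and sub: "sphere 0 1 \<inter> ball c r \<subseteq> N" and small: "N \<subseteq> ball c (1/2)"
  obtains \<omega> where "0 < \<omega>" "\<omega> \<le> 1"
    "\<And>\<epsilon>. 0 < \<epsilon> \<Longrightarrow> \<exists>b u v. norm b = 1 \<and> norm u = 1 \<and> norm v = 1 \<and> b \<bullet> u = 0 \<and> b \<bullet> v = 0 \<and> u \<bullet> v = 0 \<and>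
       b \<notin> N \<and> (\<forall>x. norm x = 1 \<and> 1 - x \<bullet> b + \<epsilon> < \<omega> * (x \<bullet> v) \<longrightarrow> x \<in> N)"
proof -
  define T where "T = (\<lambda>x. x \<bullet> c) ` (sphere 0 1 - N)"
  define l where "l = Sup T"
  have cc: "c \<bullet> c = 1"
    using c by (simp add: norm_eq_1)
  have T_le: "t \<le> 1 - r\<^sup>2 / 2" if t: "t \<in> T" for t
  proof -
    obtain x where x: "t = x \<bullet> c" "norm x = 1" "x \<notin> N"
      using t by (auto simp: T_def)
    then have "r \<le> dist x c"
      using sub by (force simp: dist_commute)
    then have "r\<^sup>2 \<le> (dist x c)\<^sup>2"
      using \<open>0 < r\<close> by (simp add: power_mono)
    then show ?thesis
      using dist_unit_inner [of x c] x c by simp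
  qed
  then have bdd: "bdd_above T" by (auto simp: bdd_above_def)
  \<comment> \<open>At height 3/5 the squared distance to \<open>c\<close> is 4/5, too large for
    \<open>N\<close>. This shows that \<open>T\<close> is nonempty and bounds \<open>l\<close> away
    from 0.\<close>
  have T35: "3/5 \<in> T"
  proof -
    obtain u where u: "norm u = 1" "u \<bullet> c = 0"
      using unit_orthogonal_to_two [of c c] dim by auto
    let ?x = "(3/5) *\<^sub>R c + (4/5) *\<^sub>R u"
    have uu: "u \<bullet> u = 1" "c \<bullet> u = 0"
      using u by (simp_all add: norm_eq_1 inner_commute)
    have "?x \<bullet> ?x = 1"
      by (simp add: inner_add_left inner_add_right u uu cc)
    then have nx: "norm ?x = 1"
      by (simp add: norm_eq_1)
    have xc: "?x \<bullet> c = 3/5"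
      by (simp add: inner_add_left u uu cc)
    have "?x \<notin> N"
    proof
      assume "?x \<in> N"
      then have "dist ?x c < 1/2"
        using small by (auto simp: dist_commute)
      then have "(dist ?x c)\<^sup>2 < (1/2)\<^sup>2"
        by (intro power_strict_mono) auto
      then show False
        using dist_unit_inner [OF nx c] xc by (simp add: power2_eq_square)
    qed
    then show ?thesis
      unfolding T_def using nx xc by (intro image_eqI [of _ _ ?x]) simp_all
  qed
  have l35: "3/5 \<le> l"
    unfolding l_def using T35 bdd by (rule cSup_upper)
  have "l \<le> 1 - r\<^sup>2/2"
    unfolding l_def using T35 T_le by (intro cSup_least) auto
  then have l1: "l < 1"
    using \<open>0 < r\<close> by (smt (verit) half_gt_zero zero_less_power)
  \<comment> \<open>The sine of the angular radius of the cap of height \<open>l\<close>.\<close>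
  define \<omega> where "\<omega> = sqrt (1 - l\<^sup>2)"
  have l2: "l\<^sup>2 < 1"
    using l35 l1 by (simp add: power_less_one_iff abs_square_less_1)
  show thesis
  proof
    show "0 < \<omega>" "\<omega> \<le> 1"
      using l2 by (simp_all add: \<omega>_def)
    fix \<epsilon> :: real
    assume "0 < \<epsilon>"
    \<comment> \<open>The cutoff 1/2 is below 3/5 and so keeps the height \<open>t\<close> of
      \<open>b\<close> positive.\<close>
    then have "l - min \<epsilon> (1/2) < Sup T"
      by (simp add: l_def)
    then obtain t where t: "t \<in> T" "l - min \<epsilon> (1/2) < t"
      using less_cSup_iff [of T] T35 bdd by blast
    then obtain b where b: "norm b = 1" "b \<notin> N" "t = b \<bullet> c"
      by (auto simp: T_def)
    have tl: "t \<le> l"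
      unfolding l_def using t(1) bdd by (rule cSup_upper)
    have t0: "0 < t" "l < t + \<epsilon>"
      using t(2) l35 by auto
    have bb: "b \<bullet> b = 1"
      using b by (simp add: norm_eq_1)
    define w where "w = c - t *\<^sub>R b"
    have ww: "w \<bullet> w = 1 - t\<^sup>2"
      by (simp add: w_def inner_diff_left inner_diff_right inner_commute b(3) bb cc power2_eq_square)
    have "t\<^sup>2 \<le> l\<^sup>2"
      using tl t0 by (simp add: power_mono)
    then have wn: "\<omega> \<le> norm w"
      by (simp add: \<omega>_def norm_eq_sqrt_inner ww)
    then have w0: "0 < norm w"
      using \<open>0 < \<omega>\<close> by linarith
    define v where "v = w /\<^sub>R norm w"
    have v: "norm v = 1" "b \<bullet> v = 0" "c = t *\<^sub>R b + norm w *\<^sub>R v"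
      using w0 by (simp_all add: v_def w_def inner_diff_right b(3) bb)
    obtain u where u: "norm u = 1" "u \<bullet> b = 0" "u \<bullet> v = 0"
      using unit_orthogonal_to_two [of b v] dim by auto
    \<comment> \<open>Otherwise \<open>t * (x \<bullet> b) + norm w * (x \<bullet> v) \<le> l < t +
      \<epsilon>\<close>, where \<open>t \<le> 1\<close> and \<open>\<omega> \<le> norm w\<close>,
      against the assumption on \<open>x\<close>.\<close>
    have "x \<in> N" if x: "norm x = 1" "1 - x \<bullet> b + \<epsilon> < \<omega> * (x \<bullet> v)" for x
    proof (rule ccontr)
      assume "x \<notin> N"
      then have "x \<bullet> c \<in> T"
        using x(1) by (auto simp: T_def)
      then have "x \<bullet> c \<le> l"
        unfolding l_def using bdd by (rule cSup_upper)
      moreover have "x \<bullet> c = t * (x \<bullet> b) + norm w * (x \<bullet> v)"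
        by (subst v(3)) (simp add: inner_add_right)
      moreover have xb: "x \<bullet> b \<le> 1"
        using inner_unit_le_one x b by blast
      then have "0 < x \<bullet> v"
        using x(2) \<open>0 < \<epsilon>\<close> \<open>0 < \<omega>\<close> by (smt (verit) mult_nonneg_nonpos)
      then have "\<omega> * (x \<bullet> v) \<le> norm w * (x \<bullet> v)"
        using wn by simp
      moreover have "t * (1 - x \<bullet> b) \<le> 1 * (1 - x \<bullet> b)"
        using tl l1 xb by (intro mult_right_mono) auto
      ultimately show False
        using x(2) t0(2) by (simp add: algebra_simps)
    qed
    then show "\<exists>b u v. norm b = 1 \<and> norm u = 1 \<and> norm v = 1 \<and> b \<bullet> u = 0 \<and> b \<bullet> v = 0 \<and> u \<bullet> v = 0 \<and>
       b \<notin> N \<and> (\<forall>x. norm x = 1 \<and> 1 - x \<bullet> b + \<epsilon> < \<omega> * (x \<bullet> v) \<longrightarrow> x \<in> N)"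
      using b u v by (metis inner_commute)
  qed
qed

section \<open>The contradiction in dimension at least two\<close>

lemma no_invariant_binary_network:
  fixes \<N> :: "(real^'n) set set"
  assumes card: "3 \<le> CARD('n)" and inv: "G_invariant SO_group \<N>" and bin: "binary_family \<N>"
    and net: "closed_k_network (top_of_set (sphere 0 1)) \<N>"
  shows False
proof -
  let ?S = "sphere (0::real^'n) 1"
  have cS: "compact ?S" by simp
  obtain c0 :: "real^'n" where c0: "c0 \<in> ?S"
    using vector_choose_size [of 1] by (metis mem_sphere_0 zero_le_one)
  obtain N c r where N: "N \<in> \<N>" "N \<subseteq> ball c0 (1/4)" "c \<in> ?S" "0 < r" "?S \<inter> ball c r \<subseteq> N"
    using small_network_member [OF net c0 _ cS, of "1/4"] by (metis zero_less_divide_1_iff zero_less_numeral)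
  have "c \<in> N"
    using N by auto
  have "N \<subseteq> ball c (1/2)"
  proof
    fix x assume "x \<in> N"
    then have "dist c0 x < 1/4" "dist c0 c < 1/4"
      using N(2) \<open>c \<in> N\<close> by auto
    then show "x \<in> ball c (1/2)"
      using dist_triangle3 [of c x c0] by simp
  qed
  moreover have "3 \<le> DIM(real^'n)" "norm c = 1"
    using card N(3) by simp_all
  ultimately obtain \<omega> where \<omega>: "0 < \<omega>" "\<omega> \<le> 1" and flat:
    "\<And>\<epsilon>. 0 < \<epsilon> \<Longrightarrow> \<exists>b u v. norm b = 1 \<and> norm u = 1 \<and> norm v = 1 \<and> b \<bullet> u = 0 \<and> b \<bullet> v = 0 \<and> u \<bullet> v = 0 \<and>
       b \<notin> N \<and> (\<forall>x. norm x = 1 \<and> 1 - x \<bullet> b + \<epsilon> < \<omega> * (x \<bullet> v) \<longrightarrow> x \<in> N)"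
    using flat_boundary_point [of c r N] N(4,5) by metis
  \<comment> \<open>Radius \<omega>/40 forces \<open>s < \<omega>/20\<close> below, so that
    second-order terms such as \<open>1 - k \<le> s\<^sup>2\<close> are negligible against the
    first-order gain \<omega> times \<open>s\<close>.\<close>
  obtain F c' r' where F: "F \<in> \<N>" "compact F" "F \<subseteq> ?S" "F \<subseteq> ball c0 (\<omega>/40)"
    and F': "c' \<in> ?S" "0 < r'" "?S \<inter> ball c' r' \<subseteq> F"
    using small_network_member [OF net c0 _ cS, of "\<omega>/40"] \<omega> by auto
  have "c' \<in> F"
    using F' by auto
  then obtain p q where pq: "p \<in> F" "q \<in> F" "dist p q = diameter F"
    using diameter_compact_attained [OF F(2)] by auto
  have F1: "norm x = 1" if "x \<in> F" for x
    using F(3) that by auto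
  \<comment> \<open>The cosine of the angular diameter: \<open>p\<close> and \<open>q\<close> being
    farthest apart means that \<open>k\<close> is the least inner product on
    \<open>F\<close>.\<close>
  define k where "k = p \<bullet> q"
  have k_le: "k \<le> x \<bullet> y" if "x \<in> F" "y \<in> F" for x y
  proof -
    have "dist x y \<le> dist p q"
      using pq(3) diameter_bounded_bound [OF compact_imp_bounded [OF F(2)]] that by metis
    then have "(dist x y)\<^sup>2 \<le> (dist p q)\<^sup>2"
      by (simp add: power_mono)
    then show ?thesis
      using dist_unit_inner [of x y] dist_unit_inner [of p q] F1 that pq(1,2) by (simp add: k_def)
  qed
  \<comment> \<open>A singleton \<open>F\<close> would make \<open>c'\<close> isolated, but a
    connected sphere with more than one point has no isolated points.\<close>
  have "p \<noteq> q"
  proof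
    assume "p = q"
    then have "k = 1"
      using F1 pq by (simp add: k_def norm_eq_1)
    have sing: "x = c'" if "x \<in> F" for x
    proof -
      have "(dist x c')\<^sup>2 \<le> 0"
        using k_le [OF that \<open>c' \<in> F\<close>] dist_unit_inner [of x c'] F1 that \<open>c' \<in> F\<close> \<open>k = 1\<close> by simp
      then show ?thesis by simp
    qed
    have "- c' \<in> ?S" "c' \<noteq> - c'"
      using F'(1) by (auto simp: eq_neg_iff_add_eq_0 simp flip: scaleR_2)
    then have "\<not> (\<exists>a. ?S = {a})"
      using F'(1) by (metis singletonD)
    moreover have "connected ?S"
      using card by (intro connected_sphere) simp
    ultimately have "c' islimpt ?S"
      using F'(1) connected_imp_perfect by metis
    then obtain x where "x \<in> ?S" "x \<noteq> c'" "dist x c' < r'"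
      using F'(2) unfolding islimpt_approachable by blast
    then show False
      using sing F'(3) by (auto simp: dist_commute)
  qed
  have k1: "k < 1"
    using dist_unit_inner [of p q] F1 pq(1,2) \<open>p \<noteq> q\<close> by (simp add: k_def) (smt (verit) dist_pos_lt zero_less_power)
  define s where "s = sqrt (1 - k\<^sup>2)"
  have "dist c0 p < \<omega>/40" "dist c0 q < \<omega>/40"
    using F(4) pq(1,2) by auto
  then have "dist p q < \<omega>/20"
    using dist_triangle3 [of p q c0] by linarith
  then have "(dist p q)\<^sup>2 < (\<omega>/20)\<^sup>2"
    by (intro power_strict_mono) auto
  then have kw: "2 - 2 * k < (\<omega>/20)\<^sup>2"
    using dist_unit_inner [of p q] F1 pq(1,2) by (simp add: k_def)
  have "(\<omega>/20)\<^sup>2 \<le> (1/20)\<^sup>2"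
    using \<omega> by (intro power_mono) auto
  then have k0: "1/2 < k"
    using kw by (simp add: power2_eq_square)
  have s2: "s\<^sup>2 = 1 - k\<^sup>2" and "0 < s"
    using k0 k1 by (simp_all add: s_def power_le_one abs_square_less_1)
  have "s\<^sup>2 \<le> 2 - 2 * k"
    using s2 zero_le_power2 [of "1 - k"] by (simp add: power2_eq_square algebra_simps)
  then have "s\<^sup>2 < (\<omega>/20)\<^sup>2"
    using kw by simp
  then have s_small: "s < \<omega>/20"
    using \<omega> by (intro power_less_imp_less_base [of s 2]) auto
  have "(1 - k) * 1 \<le> (1 - k) * (1 + k)"
    using k0 k1 by (intro mult_left_mono) auto
  then have ks: "1 - k \<le> s\<^sup>2"
    using s2 by (simp add: power2_eq_square algebra_simps)
  \<comment> \<open>The unit tangent at \<open>q\<close> pointing to \<open>p\<close>;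
    \<open>s\<close> is the sine of the angle between them.\<close>
  define e where "e = (p - k *\<^sub>R q) /\<^sub>R s"
  have pe: "p = k *\<^sub>R q + s *\<^sub>R e"
    using \<open>0 < s\<close> by (simp add: e_def)
  have qq: "q \<bullet> q = 1" "p \<bullet> p = 1" "q \<bullet> p = k"
    using F1 pq by (simp_all add: norm_eq_1 k_def inner_commute)
  have qe: "q \<bullet> e = 0"
    by (simp add: e_def inner_diff_right qq)
  have "(p - k *\<^sub>R q) \<bullet> (p - k *\<^sub>R q) = s\<^sup>2"
    unfolding s2
    by (simp add: inner_diff_left inner_diff_right qq power2_eq_square flip: k_def)
  then have ee: "e \<bullet> e = 1"
    using \<open>0 < s\<close> by (simp add: e_def power2_eq_square) (simp add: field_simps)
  define perp where "perp y = y - (y \<bullet> q) *\<^sub>R q - (y \<bullet> e) *\<^sub>R e" for y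
  \<comment> \<open>Combine \<open>k \<le> y \<bullet> p\<close> with
    \<open>y \<bullet> q \<le> 1\<close> in the expansion of \<open>p\<close>.\<close>
  have ye0: "0 \<le> y \<bullet> e" if "y \<in> F" for y
  proof -
    have "k \<le> k * (y \<bullet> q) + s * (y \<bullet> e)"
      using k_le [OF that pq(1)] by (subst (asm) pe) (simp add: inner_add_right)
    moreover have "k * (y \<bullet> q) \<le> k * 1"
      using k0 inner_unit_le_one F1 that pq by (intro mult_left_mono) auto
    ultimately have "0 \<le> s * (y \<bullet> e)" by simp
    then show ?thesis
      using \<open>0 < s\<close> by (simp add: zero_le_mult_iff)
  qed
  have perp2: "perp y \<bullet> perp y = 1 - (y \<bullet> q)\<^sup>2 - (y \<bullet> e)\<^sup>2" if "y \<in> F" for y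
    using F1 [OF that] qq qe ee
    by (simp add: perp_def norm_eq_1 inner_diff_left inner_diff_right inner_commute power2_eq_square)
  have img: "g ` F \<in> \<N>" if "g \<in> SO_group" for g
    using inv F(1) that unfolding G_invariant_def by blast
  have normSO: "norm (g x) = norm x" if "g \<in> SO_group" for g :: "real^'n \<Rightarrow> real^'n" and x
    using SO_inner [OF that, of x x] by (simp add: norm_eq)
  have three: False
    if g: "g \<in> SO_group" "h \<in> SO_group" "g q = b" "h q = b" "b \<notin> N"
      and touch: "g ` F \<inter> h ` F \<subseteq> {b}" and "x \<in> F" "g x \<in> N" "y \<in> F" "h y \<in> N" for g h b x y
  proof -
    have "g ` F \<inter> h ` F \<inter> N \<noteq> {}"
    proof (rule binary_family_three [OF bin img img \<open>N \<in> \<N>\<close>])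
      show "g ` F \<inter> h ` F \<noteq> {}"
        using g pq(2) by (metis disjoint_iff imageI)
    qed (use that in auto)
    then show False
      using touch \<open>b \<notin> N\<close> by auto
  qed
  show False
  proof (cases "\<forall>y\<in>F. norm (perp y) \<le> y \<bullet> e")
    case True
    have "0 < s * \<omega> / 20"
      using \<open>0 < s\<close> \<omega> by simp
    from flat [OF this] obtain b u v where buv: "norm b = 1" "norm u = 1" "norm v = 1"
        "b \<bullet> u = 0" "b \<bullet> v = 0" "u \<bullet> v = 0" "b \<notin> N"
      and inN: "\<And>x. norm x = 1 \<Longrightarrow> 1 - x \<bullet> b + s * \<omega> / 20 < \<omega> * (x \<bullet> v) \<Longrightarrow> x \<in> N"
      by auto
    have bb: "b \<bullet> b = 1" "u \<bullet> u = 1" "v \<bullet> v = 1" "u \<bullet> b = 0" "v \<bullet> b = 0" "v \<bullet> u = 0"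
      using buv by (simp_all add: norm_eq_1 inner_commute)
    \<comment> \<open>The two axes enclose more than 90 degrees, so 45-degree cones about them are
      disjoint, while the component 3/5 along \<open>v\<close> still carries the copies of
      \<open>p\<close> into \<open>N\<close>.\<close>
    define w where "w \<sigma> = (\<sigma> * 4/5) *\<^sub>R u + (3/5) *\<^sub>R v" for \<sigma>
    have copy: "\<exists>g. g \<in> SO_group \<and> g q = b \<and> g e = w \<sigma> \<and> g p \<in> N" if \<sigma>: "\<sigma> * \<sigma> = 1" for \<sigma>
    proof -
      have ww: "w \<sigma> \<bullet> w \<sigma> = 1" "b \<bullet> w \<sigma> = 0" "w \<sigma> \<bullet> b = 0" "w \<sigma> \<bullet> v = 3/5"
        using \<sigma> by (simp_all add: w_def inner_add_left inner_add_right bb buv power2_eq_square)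
      obtain g where g: "g \<in> SO_group" "g q = b" "g e = w \<sigma>"
        using SO_two_point_transitive [OF card, of q b e "w \<sigma>"] qe ww qq ee bb by (auto simp: norm_eq)
      then have gp: "g p = k *\<^sub>R b + s *\<^sub>R w \<sigma>"
        by (subst pe) (simp add: SO_group_def orthogonal_transformation_def linear_add linear_scale)
      have "g p \<in> N"
      proof (rule inN)
        show "norm (g p) = 1"
          using normSO [OF g(1)] F1 pq by simp
        have "s * s < s * (\<omega>/20)"
          using s_small \<open>0 < s\<close> by simp
        moreover have "0 < s * \<omega>"
          using \<open>0 < s\<close> \<omega> by simp
        ultimately show "1 - g p \<bullet> b + s * \<omega> / 20 < \<omega> * (g p \<bullet> v)"
          using ks by (simp add: gp inner_add_left ww bb buv power2_eq_square algebra_simps)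
      qed
      with g show ?thesis by blast
    qed
    obtain g where g: "g \<in> SO_group" "g q = b" "g e = w 1" "g p \<in> N"
      using copy [of 1] by auto
    obtain h where h: "h \<in> SO_group" "h q = b" "h e = w (-1)" "h p \<in> N"
      using copy [of "-1"] by auto
    have "x = b" if x: "x \<in> g ` F" "x \<in> h ` F" for x
    proof -
      \<comment> \<open>The part of \<open>x\<close> orthogonal to \<open>b\<close>. Adding the two
        cone bounds cancels \<open>u\<close> and gives 2 |\<xi>| at most 9/5 |\<xi>|, hence \<xi> =
        0; positivity of \<open>x \<bullet> b\<close> then excludes \<open>-b\<close>.\<close>
      define \<xi> where "\<xi> = x - (x \<bullet> b) *\<^sub>R b"
      obtain y where y: "y \<in> F" "x = g y" using x by auto
      obtain z where z: "z \<in> F" "x = h z" using x by auto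
      have xx: "x \<bullet> x = 1"
        using y normSO [OF g(1)] F1 by (simp add: norm_eq_1 [symmetric])
      have xi2: "\<xi> \<bullet> \<xi> = 1 - (x \<bullet> b)\<^sup>2"
        by (simp add: \<xi>_def inner_diff_left inner_diff_right inner_commute xx bb power2_eq_square)
      have cone: "norm \<xi> \<le> sqrt 2 * (x \<bullet> f e)"
        if f: "f \<in> SO_group" "f q = b" "x = f y" "y \<in> F" for f y
      proof -
        have xe: "x \<bullet> b = y \<bullet> q" "x \<bullet> f e = y \<bullet> e"
          using f SO_inner by metis+
        have "norm (perp y) \<le> y \<bullet> e"
          using True f by blast
        then have "(norm (perp y))\<^sup>2 \<le> (y \<bullet> e)\<^sup>2"
          by (simp add: power_mono)
        then have "(norm \<xi>)\<^sup>2 \<le> 2 * (y \<bullet> e)\<^sup>2"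
          using perp2 [OF f(4)] xi2 by (simp add: power2_norm_eq_inner xe)
        also have "\<dots> = (sqrt 2 * (y \<bullet> e))\<^sup>2"
          by (simp add: power_mult_distrib)
        finally show ?thesis
          unfolding xe by (rule power2_le_imp_le) (simp add: ye0 [OF f(4)])
      qed
      have "norm \<xi> \<le> sqrt 2 * (x \<bullet> w 1)" "norm \<xi> \<le> sqrt 2 * (x \<bullet> w (-1))"
        using cone [OF g(1,2) y(2,1)] cone [OF h(1,2) z(2,1)] g(3) h(3) by simp_all
      then have "2 * norm \<xi> \<le> sqrt 2 * (x \<bullet> w 1 + x \<bullet> w (-1))"
        by (simp add: algebra_simps)
      also have "x \<bullet> w 1 + x \<bullet> w (-1) = 6/5 * (\<xi> \<bullet> v)"
        by (simp add: w_def \<xi>_def inner_add_right inner_diff_left inner_diff_right buv)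
      also have "sqrt 2 * (6/5 * (\<xi> \<bullet> v)) \<le> 3/2 * (6/5 * norm \<xi>)"
      proof -
        have "\<xi> \<bullet> v \<le> norm \<xi>"
          using norm_cauchy_schwarz [of \<xi> v] buv by simp
        moreover have "sqrt 2 \<le> 3/2"
          by (rule real_le_lsqrt) (simp_all add: power2_eq_square)
        ultimately have "sqrt 2 * (\<xi> \<bullet> v) \<le> 3/2 * norm \<xi>"
          by (smt (verit) mult_left_mono mult_right_mono norm_ge_zero real_sqrt_ge_zero)
        then show ?thesis by (simp add: mult.commute)
      qed
      finally have "\<xi> = 0" by simp
      then have "(x \<bullet> b)\<^sup>2 = 1" "x = (x \<bullet> b) *\<^sub>R b"
        using xi2 by (simp_all add: \<xi>_def)
      moreover have "x \<bullet> b = y \<bullet> q"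
        using y g SO_inner by metis
      then have "0 < x \<bullet> b"
        using k_le [OF y(1) pq(2)] k0 by simp
      ultimately show "x = b"
        by (metis power2_eq_1_iff scaleR_one not_less_iff_gr_or_eq zero_less_one neg_less_0_iff_less)
    qed
    then show False
      using three [OF g(1) h(1) g(2) h(2) buv(7) _ pq(1) g(4) pq(1) h(4)] by blast
  next
    case False
    then obtain y where y: "y \<in> F" "y \<bullet> e < norm (perp y)"
      by force
    define m where "m = norm (perp y)"
    have m0: "0 < m"
      using y ye0 [OF y(1)] unfolding m_def by linarith
    have yqk: "k \<le> y \<bullet> q"
      using k_le y pq by simp
    have m2: "m\<^sup>2 = 1 - (y \<bullet> q)\<^sup>2 - (y \<bullet> e)\<^sup>2"
      using perp2 [OF y(1)] by (simp add: m_def power2_norm_eq_inner)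
    have "k\<^sup>2 \<le> (y \<bullet> q)\<^sup>2"
      using yqk k0 by (intro power_mono) auto
    then have "m\<^sup>2 \<le> s\<^sup>2"
      using m2 s2 zero_le_power2 [of "y \<bullet> e"] by linarith
    then have ms: "m \<le> s"
      by (rule power2_le_imp_le) (use \<open>0 < s\<close> in simp)
    \<comment> \<open>Since \<open>y\<close> lies outside the cone, 1 - (y \<bullet> q)^2 = m^2 + (y
      \<bullet> e)^2 is at most 2 m^2.\<close>
    have yq: "1 - y \<bullet> q \<le> 2 * m\<^sup>2"
    proof -
      have "(y \<bullet> e)\<^sup>2 \<le> m\<^sup>2"
        using y ye0 [OF y(1)] by (simp add: m_def power_mono)
      moreover have "y \<bullet> q \<le> 1"
        using inner_unit_le_one F1 y pq by blast
      then have "(1 - y \<bullet> q) * 1 \<le> (1 - y \<bullet> q) * (1 + y \<bullet> q)"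
        using yqk k0 by (intro mult_left_mono) auto
      ultimately show ?thesis
        using m2 by (simp add: algebra_simps power2_eq_square)
    qed
    have "0 < m * \<omega> / 20"
      using m0 \<omega> by simp
    from flat [OF this] obtain b u v where buv: "norm b = 1" "norm u = 1" "norm v = 1"
        "b \<bullet> u = 0" "b \<bullet> v = 0" "u \<bullet> v = 0" "b \<notin> N"
      and inN: "\<And>x. norm x = 1 \<Longrightarrow> 1 - x \<bullet> b + m * \<omega> / 20 < \<omega> * (x \<bullet> v) \<Longrightarrow> x \<in> N"
      by auto
    have bb: "b \<bullet> b = 1" "u \<bullet> u = 1" "v \<bullet> v = 1" "u \<bullet> b = 0" "v \<bullet> b = 0" "v \<bullet> u = 0"
      using buv by (simp_all add: norm_eq_1 inner_commute)
    define z where "z = perp y /\<^sub>R m"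
    have z: "norm z = 1" "y = (y \<bullet> q) *\<^sub>R q + (y \<bullet> e) *\<^sub>R e + m *\<^sub>R z"
      using m0 by (simp_all add: z_def m_def perp_def)
    have "q \<bullet> z = 0" "e \<bullet> z = 0"
      using qe by (simp_all add: z_def perp_def inner_diff_right qq ee inner_commute)
    \<comment> \<open>Together with \<open>b\<close> these form an orthonormal triple. The axis of
      \<open>h\<close> points away from \<open>N\<close> by 3/5 and that of \<open>g\<close> towards
      it by as much; \<open>w'\<close> gains 4/5, so \<open>h y\<close> gains at least
      \<open>m/5\<close> along \<open>v\<close>. Only these \<open>v\<close>-components matter,
      whence either sign of \<sigma> will do.\<close>
    define w w' where "w \<sigma> = (\<sigma> * 4/5) *\<^sub>R u - (3/5) *\<^sub>R v"
      and "w' \<sigma> = (\<sigma> * 3/5) *\<^sub>R u + (4/5) *\<^sub>R v" for \<sigma>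
    have ww: "w \<sigma> \<bullet> w \<sigma> = 1" "w' \<sigma> \<bullet> w' \<sigma> = 1" "w \<sigma> \<bullet> w' \<sigma> = 0" if "\<sigma> * \<sigma> = 1" for \<sigma>
      using that by (simp_all add: w_def w'_def inner_add_left inner_add_right inner_diff_left
          inner_diff_right bb buv power2_eq_square)
    have wb: "w \<sigma> \<bullet> b = 0" "w' \<sigma> \<bullet> b = 0" "b \<bullet> w \<sigma> = 0" "b \<bullet> w' \<sigma> = 0"
       "w \<sigma> \<bullet> v = -3/5" "w' \<sigma> \<bullet> v = 4/5" for \<sigma>
      by (simp_all add: w_def w'_def inner_add_left inner_add_right inner_diff_left
          inner_diff_right bb buv)
    \<comment> \<open>In dimension 3 the orientation dictates the sign.\<close>
    obtain \<sigma> h where \<sigma>: "\<sigma> * \<sigma> = 1" and h: "h \<in> SO_group" "h q = b" "h e = w \<sigma>" "h z = w' \<sigma>"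
    proof -
      obtain f where f: "orthogonal_transformation f" "f q = b" "f e = w 1" "f z = w' 1"
        using orthogonal_transformation_extending_isometry [of q b e "w 1" z "w' 1"] ww [of 1] wb [of 1]
          qq ee qe z \<open>q \<bullet> z = 0\<close> \<open>e \<bullet> z = 0\<close> bb by (auto simp: norm_eq norm_eq_1)
      have "u \<noteq> 0" using buv by auto
      have refl: "reflection_along u b = b" "reflection_along u (w 1) = w (-1)"
        "reflection_along u (w' 1) = w' (-1)"
        by (simp_all add: reflection_along_def w_def w'_def inner_add_left inner_diff_left bb buv
            flip: scaleR_left_diff_distrib scaleR_left.diff)
      show thesis
        using SO_or_reflected_SO [OF f(1) \<open>u \<noteq> 0\<close>]
      proof
        assume "f \<in> SO_group"
        then show thesis using that [of 1 f] f by simp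
      next
        assume "reflection_along u \<circ> f \<in> SO_group"
        then show thesis using that [of "-1" "reflection_along u \<circ> f"] f refl by simp
      qed
    qed
    obtain g where g: "g \<in> SO_group" "g q = b" "g e = - w \<sigma>"
      using SO_two_point_transitive [OF card, of q b e "- w \<sigma>"] qe ww [OF \<sigma>] wb [of \<sigma>] qq ee bb
      by (auto simp: norm_eq)
    have gp: "g p = k *\<^sub>R b - s *\<^sub>R w \<sigma>"
      using g by (subst pe) (simp add: SO_group_def orthogonal_transformation_def linear_add linear_scale)
    have hp: "h p = k *\<^sub>R b + s *\<^sub>R w \<sigma>"
      using h by (subst pe) (simp add: SO_group_def orthogonal_transformation_def linear_add linear_scale)
    have hy: "h y = (y \<bullet> q) *\<^sub>R b + (y \<bullet> e) *\<^sub>R w \<sigma> + m *\<^sub>R w' \<sigma>"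
      using h by (subst z(2)) (simp add: SO_group_def orthogonal_transformation_def linear_add linear_scale)
    have gpN: "g p \<in> N"
    proof (rule inN)
      show "norm (g p) = 1"
        using normSO [OF g(1)] F1 pq by simp
      have "s * s < s * (\<omega>/20)"
        using s_small \<open>0 < s\<close> by simp
      moreover have "0 < s * \<omega>" "m * \<omega> \<le> s * \<omega>"
        using \<open>0 < s\<close> \<omega> ms by simp_all
      ultimately show "1 - g p \<bullet> b + m * \<omega> / 20 < \<omega> * (g p \<bullet> v)"
        using ks by (simp add: gp inner_diff_left wb bb buv power2_eq_square algebra_simps)
    qed
    have hyN: "h y \<in> N"
    proof (rule inN)
      show "norm (h y) = 1"
        using normSO [OF h(1)] F1 y by simp
      have "m * m < m * (\<omega>/20)"
        using s_small ms m0 by simp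
      moreover have "\<omega> * (y \<bullet> e) \<le> \<omega> * m"
        using y \<omega> by (simp add: m_def)
      moreover have "0 < m * \<omega>"
        using m0 \<omega> by simp
      ultimately show "1 - h y \<bullet> b + m * \<omega> / 20 < \<omega> * (h y \<bullet> v)"
        using yq by (simp add: hy inner_add_left wb bb buv power2_eq_square algebra_simps)
    qed
    \<comment> \<open>Maximality of the diameter bounds the products of \<open>x\<close> with both
      \<open>g p\<close> and \<open>h p\<close> below by \<open>k\<close>. In the sum the opposite
      terms in \<open>w\<close> cancel, leaving \<open>1 \<le> x \<bullet> b\<close>.\<close>
    have "x = b" if x: "x \<in> g ` F" "x \<in> h ` F" for x
    proof -
      obtain y' where y': "y' \<in> F" "x = g y'" using x by auto
      obtain z' where z': "z' \<in> F" "x = h z'" using x by auto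
      have "k \<le> x \<bullet> g p" "k \<le> x \<bullet> h p"
        using k_le pq(1) y' z' SO_inner [OF g(1)] SO_inner [OF h(1)] by metis+
      then have "k * 1 \<le> k * (x \<bullet> b)"
        by (simp add: gp hp inner_diff_right inner_add_right)
      then have "1 \<le> x \<bullet> b"
        using k0 by simp
      moreover have "norm x = 1"
        using y' normSO [OF g(1)] F1 by simp
      ultimately have "(dist x b)\<^sup>2 \<le> 0"
        using dist_unit_inner [of x b] buv by simp
      then show ?thesis by simp
    qed
    then show False
      using three [OF g(1) h(1) g(2) h(2) buv(7) _ pq(1) gpN y(1) hyN] by blast
  qed
qed

section \<open>Spheres of dimension at most one\<close>

text \<open>The bound 1/2 makes a chain of three radii, at most 3/2, shorter than the distance 2
  between antipodes.\<close>

definition sphere_caps :: "('a::euclidean_space) set set" where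
  "sphere_caps = {sphere 0 1 \<inter> cball u r | u r. norm u = 1 \<and> 0 \<le> r \<and> r \<le> 1/2}"

text \<open>The cap is the radial projection of the convex cone \<open>C\<close>; in terms of inner
  products it is the part of the sphere at height at least \<open>k\<close> over
  \<open>u\<close>.\<close>

lemma connected_sphere_cap:
  fixes u :: "'a::euclidean_space"
  assumes "norm u = 1" "0 \<le> r" "r \<le> 1/2"
  shows "connected (sphere 0 1 \<inter> cball u r)"
proof -
  define k where "k = 1 - r\<^sup>2 / 2"
  have "r\<^sup>2 \<le> (1/2)\<^sup>2"
    using assms by (intro power_mono) auto
  then have "0 < k"
    by (simp add: k_def power2_eq_square)
  define C where "C = {y. 0 < y \<bullet> u \<and> k * norm y \<le> y \<bullet> u}"
  have "convex C"
  proof (rule convexI)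
    fix x y :: 'a and a b :: real
    assume xy: "x \<in> C" "y \<in> C" and ab: "0 \<le> a" "0 \<le> b" "a + b = 1"
    have "0 < a * (x \<bullet> u) + b * (y \<bullet> u)"
      using xy ab unfolding C_def
      by (smt (verit) mem_Collect_eq mult_nonneg_nonneg mult_pos_pos)
    moreover have "k * norm (a *\<^sub>R x + b *\<^sub>R y) \<le> a * (x \<bullet> u) + b * (y \<bullet> u)"
    proof -
      have "k * norm (a *\<^sub>R x + b *\<^sub>R y) \<le> k * (a * norm x + b * norm y)"
        using \<open>0 < k\<close> ab norm_triangle_ineq [of "a *\<^sub>R x" "b *\<^sub>R y"] by simp
      also have "\<dots> = a * (k * norm x) + b * (k * norm y)"
        by (simp add: algebra_simps)
      also have "\<dots> \<le> a * (x \<bullet> u) + b * (y \<bullet> u)"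
        using xy ab unfolding C_def by (intro add_mono mult_left_mono) auto
      finally show ?thesis .
    qed
    ultimately show "a *\<^sub>R x + b *\<^sub>R y \<in> C"
      by (simp add: C_def inner_add_left)
  qed
  moreover have C0: "y \<noteq> 0" if "y \<in> C" for y
    using that by (auto simp: C_def)
  then have "continuous_on C (\<lambda>y. y /\<^sub>R norm y)"
    by (intro continuous_intros) auto
  ultimately have "connected ((\<lambda>y. y /\<^sub>R norm y) ` C)"
    by (intro connected_continuous_image convex_connected)
  moreover have cap: "x \<in> cball u r \<longleftrightarrow> k \<le> x \<bullet> u" if "norm x = 1" for x
  proof -
    have "x \<in> cball u r \<longleftrightarrow> (dist x u)\<^sup>2 \<le> r\<^sup>2"
      using assms(2) by (simp add: dist_commute)
    also have "\<dots> \<longleftrightarrow> k \<le> x \<bullet> u"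
      unfolding dist_unit_inner [OF that assms(1)] k_def by auto
    finally show ?thesis .
  qed
  have "(\<lambda>y. y /\<^sub>R norm y) ` C = sphere 0 1 \<inter> cball u r"
  proof (intro equalityI subsetI)
    fix x assume "x \<in> (\<lambda>y. y /\<^sub>R norm y) ` C"
    then obtain y where y: "y \<in> C" "x = y /\<^sub>R norm y" by blast
    have "0 < norm y"
      using C0 [OF y(1)] by simp
    then have "norm x = 1" "k \<le> x \<bullet> u"
      using y by (simp_all add: C_def field_simps)
    then show "x \<in> sphere 0 1 \<inter> cball u r"
      using cap by simp
  next
    fix x assume "x \<in> sphere 0 1 \<inter> cball u r"
    then have x: "norm x = 1" "k \<le> x \<bullet> u"
      using cap by auto
    then show "x \<in> (\<lambda>y. y /\<^sub>R norm y) ` C"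
      using \<open>0 < k\<close> by (intro image_eqI [of _ _ x]) (auto simp: C_def)
  qed
  ultimately show ?thesis by simp
qed

section \<open>Linked caps on the circle and on two points\<close>

text \<open>Removing a point leaves a copy of the line for the circle and a single point for the
  sphere of dimension 0; \<open>T\<close> covers both cases.\<close>

lemma punctured_low_dim_sphere_embeds_in_real:
  fixes b :: "'a::euclidean_space"
  assumes "DIM('a) \<le> 2" "norm b = 1"
  obtains f :: "'a \<Rightarrow> real" where "continuous_on (sphere 0 1 - {b}) f" "inj_on f (sphere 0 1 - {b})"
proof -
  define T :: "real set" where "T = (if DIM('a) = 2 then UNIV else {0})"
  have "affine T" "aff_dim T + 1 = DIM('a)"
    using assms(1) DIM_positive [where 'a='a] unfolding T_def by (auto simp: le_Suc_eq numeral_2_eq_2)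
  then have "(sphere 0 1 - {b}) homeomorphic T"
    using homeomorphic_punctured_sphere_affine [of 1 b 0 T] assms by simp
  then obtain f g where "homeomorphism (sphere 0 1 - {b}) T f g"
    unfolding homeomorphic_def by blast
  then show thesis
    using that [of f] homeomorphism_cont1 homeomorphism_apply1 inj_on_inverseI by metis
qed

lemma binary_sphere_caps:
  assumes "DIM('a::euclidean_space) \<le> 2"
  shows "binary_family (sphere_caps :: 'a set set)"
  unfolding binary_family_def centered_family_def
proof (intro allI impI, elim conjE)
  fix \<B> \<F> :: "'a set set"
  assume caps: "\<B> \<subseteq> sphere_caps" and linked: "linked_family \<B>" and \<F>: "\<F> \<subseteq> \<B>" "finite \<F>"
  show "\<Inter>\<F> \<noteq> {}"
  proof (cases "\<F> = {}")
    case False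
    then obtain A where A: "A \<in> \<F>" by blast
    have \<F>_caps: "B \<in> sphere_caps" if "B \<in> \<F>" for B
      using that \<F> caps by blast
    obtain u r where u: "A = sphere 0 1 \<inter> cball u r" "norm u = 1" "r \<le> 1/2"
      using \<F>_caps [OF A] by (auto simp: sphere_caps_def)
    have meet: "B \<inter> C \<noteq> {}" if "B \<in> \<F>" "C \<in> \<F>" for B C
      using linked \<F> that unfolding linked_family_def by blast
    let ?P = "sphere 0 1 - {- u}"
    \<comment> \<open>If a cap linked with \<open>A\<close> contained \<open>-u\<close>, the path
      from \<open>-u\<close> through its centre and a common point to \<open>u\<close> would be too
      short.\<close>
    have sub: "B \<subseteq> ?P" if B: "B \<in> \<F>" for B
    proof -
      obtain v d where v: "B = sphere 0 1 \<inter> cball v d" "d \<le> 1/2"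
        using \<F>_caps [OF B] by (auto simp: sphere_caps_def)
      obtain z where z: "z \<in> A" "z \<in> B"
        using meet [OF A B] by blast
      have "- u \<notin> B"
      proof
        assume "- u \<in> B"
        then have "dist (- u) v \<le> 1/2" "dist v z \<le> 1/2" "dist z u \<le> 1/2"
          using z u v by (auto simp: dist_commute)
        moreover have "- u - u = - (2 *\<^sub>R u)"
          by (simp add: scaleR_2)
        then have "dist (- u) u = 2"
          using u(2) by (simp add: dist_norm)
        ultimately show False
          using dist_triangle [of "- u" u v] dist_triangle [of v u z] by linarith
      qed
      then show ?thesis
        using v by auto
    qed
    obtain f :: "'a \<Rightarrow> real" where f: "continuous_on ?P f" "inj_on f ?P"
      using punctured_low_dim_sphere_embeds_in_real [OF assms, of "- u"] u(2) by auto
    let ?\<G> = "(`) f ` \<F>"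
    have "\<Inter>?\<G> \<noteq> {}"
    \<comment> \<open>Helly's theorem on the line needs at least two distinct sets, so the case of a
      single image is separate.\<close>
    proof (cases "2 \<le> card ?\<G>")
      case True
      show ?thesis
      proof (rule Helly)
        show "DIM(real) + 1 \<le> card ?\<G>"
          using True by simp
        show "\<forall>s\<in>?\<G>. convex s"
        proof
          fix s assume "s \<in> ?\<G>"
          then obtain B where B: "B \<in> \<F>" "s = f ` B" by blast
          then have "connected B"
            using \<F>_caps connected_sphere_cap by (fastforce simp: sphere_caps_def)
          then show "convex s"
            using B sub [OF B(1)] continuous_on_subset [OF f(1)] connected_continuous_image
            by (metis connected_convex_1)
        qed
        show "\<And>t. t \<subseteq> ?\<G> \<Longrightarrow> card t = DIM(real) + 1 \<Longrightarrow> \<Inter>t \<noteq> {}"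
        proof -
          fix t assume t: "t \<subseteq> ?\<G>" "card t = DIM(real) + 1"
          then obtain X Y where XY: "t = {X, Y}"
            by (metis card_2_iff DIM_real one_add_one)
          then obtain B C where "B \<in> \<F>" "C \<in> \<F>" "X = f ` B" "Y = f ` C"
            using t(1) by auto
          then show "\<Inter>t \<noteq> {}"
            using meet [of B C] XY by auto
        qed
      qed
    next
      case False
      then have "card ?\<G> = 1"
        using A \<F>(2) by (metis One_nat_def Suc_leI card_gt_0_iff finite_imageI image_is_empty empty_iff
            le_antisym not_less_eq_eq numeral_2_eq_2)
      then obtain X where "?\<G> = {X}"
        by (metis card_1_singletonE)
      moreover have "f ` A \<noteq> {}"
        using meet [OF A A] by auto
      ultimately show ?thesis
        using A by (metis cInf_singleton imageI singletonD)
    qed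
    then obtain t where t: "\<And>B. B \<in> \<F> \<Longrightarrow> t \<in> f ` B"
      by blast
    then obtain x where x: "x \<in> A" "t = f x"
      using A by blast
    have "x \<in> B" if B: "B \<in> \<F>" for B
    proof -
      obtain y where "y \<in> B" "f x = f y"
        using t [OF B] by (auto simp: x(2))
      then show ?thesis
        using inj_onD [OF f(2), of x y] sub [OF B] sub [OF A] x(1) by blast
    qed
    then show ?thesis by blast
  qed simp
qed

section \<open>Network property and invariance of the caps\<close>

lemma closed_k_network_sphere_caps:
  "closed_k_network (top_of_set (sphere (0::'a::euclidean_space) 1)) sphere_caps"
  unfolding closed_k_network_def
proof (intro conjI allI impI ballI)
  fix N :: "'a set" assume "N \<in> sphere_caps"
  then show "closedin (top_of_set (sphere 0 1)) N"
    by (auto simp: sphere_caps_def closedin_closed_Int)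
next
  fix U K :: "'a set"
  let ?S = "sphere (0::'a) 1"
  assume UK: "openin (top_of_set ?S) U \<and> compactin (top_of_set ?S) K \<and> K \<subseteq> U"
  then have K: "compact K" "K \<subseteq> ?S"
    by (simp_all add: compactin_subtopology)
  have "\<exists>r. 0 < r \<and> r \<le> 1/2 \<and> ?S \<inter> cball x r \<subseteq> U" if "x \<in> K" for x
  proof -
    obtain e where "0 < e" "cball x e \<inter> ?S \<subseteq> U"
      using UK \<open>x \<in> K\<close> openin_contains_cball by (metis subsetD)
    then show ?thesis
      by (intro exI [of _ "min e (1/2)"]) auto
  qed
  then obtain r where r: "\<And>x. x \<in> K \<Longrightarrow> 0 < r x \<and> r x \<le> 1/2 \<and> ?S \<inter> cball x (r x) \<subseteq> U"
    by metis
  obtain C where C: "C \<subseteq> K" "finite C" "K \<subseteq> (\<Union>x\<in>C. ball x (r x))"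
    using compactE_image [OF K(1), of K "\<lambda>x. ball x (r x)"] r
    by (metis (no_types, lifting) UN_iff centre_in_ball open_ball subsetI)
  let ?\<F> = "(\<lambda>x. ?S \<inter> cball x (r x)) ` C"
  show "\<exists>\<F>. finite \<F> \<and> \<F> \<subseteq> sphere_caps \<and> K \<subseteq> \<Union>\<F> \<and> \<Union>\<F> \<subseteq> U"
  proof (intro exI conjI)
    show "finite ?\<F>"
      using C by simp
    show "?\<F> \<subseteq> sphere_caps"
    proof
      fix B assume "B \<in> ?\<F>"
      then obtain x where x: "x \<in> C" "B = ?S \<inter> cball x (r x)" by blast
      then have "norm x = 1" "0 \<le> r x" "r x \<le> 1/2"
        using C(1) K(2) r by (force intro: less_imp_le)+
      then show "B \<in> sphere_caps"
        unfolding sphere_caps_def x(2) by blast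
    qed
    show "K \<subseteq> \<Union>?\<F>"
      using C(3) K(2) by (auto simp: subset_iff intro: less_imp_le) (metis less_imp_le)
    show "\<Union>?\<F> \<subseteq> U"
      using r C(1) by blast
  qed
qed

lemma G_invariant_sphere_caps: "G_invariant SO_group (sphere_caps :: (real^'n) set set)"
  unfolding G_invariant_def
proof (intro ballI)
  fix g :: "real^'n \<Rightarrow> real^'n" and A :: "(real^'n) set"
  assume g: "g \<in> SO_group" and "A \<in> sphere_caps"
  then obtain u r where u: "A = sphere 0 1 \<inter> cball u r" "norm u = 1" "0 \<le> r" "r \<le> 1/2"
    unfolding sphere_caps_def by blast
  have ot: "orthogonal_transformation g"
    using g by (simp add: SO_group_def)
  have inj: "inj g" and g0: "g 0 = 0"
    using ot by (simp_all add: orthogonal_transformation_inj orthogonal_transformation_linear linear_0)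
  \<comment> \<open>The sphere is a closed ball minus an open ball, and \<open>g\<close> preserves
    both.\<close>
  have "g ` sphere 0 1 = sphere 0 1"
    unfolding cball_diff_eq_sphere [symmetric]
    by (simp add: image_set_diff [OF inj] image_orthogonal_transformation_ball [OF ot]
        image_orthogonal_transformation_cball [OF ot] g0)
  then have "g ` A = sphere 0 1 \<inter> cball (g u) r"
    by (simp add: u(1) image_Int [OF inj] image_orthogonal_transformation_cball [OF ot])
  moreover have "norm (g u) = 1"
    using u ot by (simp add: orthogonal_transformation_norm)
  ultimately show "g ` A \<in> sphere_caps"
    using u unfolding sphere_caps_def by blast
qed

theorem theorem1p4:
  shows "G_supercompact (top_of_set (sphere (0::real^'n) 1)) (SO_group :: (real^'n \<Rightarrow> real^'n) set)
         \<longleftrightarrow> CARD('n) \<le> 2"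
proof
  assume "G_supercompact (top_of_set (sphere (0::real^'n) 1)) (SO_group :: (real^'n \<Rightarrow> real^'n) set)"
  then show "CARD('n) \<le> 2"
    unfolding G_supercompact_def using no_invariant_binary_network
    by (metis not_less_eq_eq eval_nat_numeral(3))
next
  assume "CARD('n) \<le> 2"
  then have "binary_family (sphere_caps :: (real^'n) set set)"
    by (intro binary_sphere_caps) simp
  then show "G_supercompact (top_of_set (sphere (0::real^'n) 1)) (SO_group :: (real^'n \<Rightarrow> real^'n) set)"
    unfolding G_supercompact_def
    using G_invariant_sphere_caps closed_k_network_sphere_caps
    by (auto simp: compact_space_subtopology)
qed

end
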